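(* Let $n\ge 2$, $\tau\in\{1,\dots,n\}$, and let $f_1,\dots,f_n:\mathbb{R}^d\to\mathbb{R}$ be differentiable and convex, with $f_i$ being $L_i$-smooth, $L_i>0$; let $f=\frac1n\sum_{i=1}^n f_i$ and $L_{\max}=\max_i L_i$. Suppose there is $x_\star\in\mathbb{R}^d$ with $\nabla f_i(x_\star)=0$ for all $i$ (interpolation regime). Let $0<\gamma<+\infty$ and let $L_{\gamma}$ be the smoothness constant of $M^\gamma$. Define $$L_{\gamma,\tau}=\frac{n-\tau}{\tau(n-1)}\frac{L_{\max}}{1+\gamma L_{\max}}+\frac{n(\tau-1)}{\tau(n-1)}L_\gamma,\qquad C(\gamma,\tau,\alpha)=\frac{1+\gamma L_{\max}}{\alpha\gamma\,(2-\alpha\gamma L_{\gamma,\tau})}.$$ Run FedExProx with $\tau$-nice sampling, step size $\gamma$ and constant extrapolation parameter $\alpha_k=\alpha\in\left(0,\frac{2}{\gamma L_{\gamma,\tau}}\right)$ from $x_0\in\mathbb{R}^d$ for $K\ge1$ iterations. Then $$\mathbb{E}[f(\bar x_K)]-\inf f\le C(\gamma,\tau,\alpha)\cdot\frac{\|x_0-x_\star\|^2}{K},$$ where $\bar x_K$ is sampled uniformly at random from the first $K$ iterates $\{x_0,x_1,\dots,x_{K-1}\}$. Moreover, for fixed $\gamma$ and $\tau$, the optimal constant extrapolation parameter (the minimizer of $\alpha\mapsto C(\gamma,\tau,\alpha)$ on $(0,\frac{2}{\gamma L_{\gamma,\tau}})$) is $\alpha_{\gamma,\tau}=\frac{1}{\gamma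 L_{\gamma,\tau}}>1$, and with $\alpha=\alpha_{\gamma,\tau}$ one has $$\mathbb{E}[f(\bar x_K)]-\inf f\le C(\gamma,\tau,\alpha_{\gamma,\tau})\cdot\frac{\|x_0-x_\star\|^2}{K}=L_{\gamma,\tau}(1+\gamma L_{\max})\cdot\frac{\|x_0-x_\star\|^2}{K}.$$
   Context: $\|\cdot\|$ is the Euclidean norm. A differentiable $\phi:\mathbb{R}^d\to\mathbb{R}$ is $L$-smooth if $\phi(x)-\phi(y)-\langle\nabla\phi(y),x-y\rangle\le\frac L2\|x-y\|^2$ for all $x,y$. Proximity operator: $\mathrm{prox}_{\gamma\phi}(x)=\arg\min_{z}\{\phi(z)+\frac1{2\gamma}\|z-x\|^2\}$ (unique for proper closed convex $\phi$, assumed evaluated exactly). Moreau envelope: $M^\gamma_\phi(x)=\min_z\{\phi(z)+\frac1{2\gamma}\|z-x\|^2\}$. $M^\gamma=\frac1n\sum_{i=1}^n M^\gamma_{f_i}$. Convention on $L_\gamma$: $L_\gamma>0$, $M^\gamma$ is $L_\gamma$-smooth and $L_\gamma\le\frac1n\sum_{i=1}^n\frac{L_i}{1+\gamma L_i}$ (such a constant always exists). FedExProx with $\tau$-nice sampling: starting at $x_0$, at each iteration $k$ a set $S_k\subseteq\{1,\dots,n\}$ is sampled uniformly at random (independently of the past) among all subsets of cardinality $\tau$, and $x_{k+1}=x_k+\alpha_k\left(\frac1\tau\sum_{i\in S_k}\mathrm{prox}_{\gamma f_i}(x_k)-x_k\right)$. The expectation is over all the randomness. *)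

theory Defs
  imports "HOL-Analysis.Analysis" "HOL-Probability.Probability"
begin

definition gradient :: "('a::real_inner \<Rightarrow> real) \<Rightarrow> 'a \<Rightarrow> 'a" where
  "gradient \<phi> x = (THE g. GDERIV \<phi> x :> g)"

definition L_smooth :: "real \<Rightarrow> ('a::real_inner \<Rightarrow> real) \<Rightarrow> bool" where
  "L_smooth L \<phi> \<longleftrightarrow>
     (\<forall>x. \<phi> differentiable (at x)) \<and>
     (\<forall>x y. \<phi> x - \<phi> y - inner (gradient \<phi> y) (x - y) \<le> L / 2 * (norm (x - y))\<^sup>2)"

definition prox :: "real \<Rightarrow> ('a::real_inner \<Rightarrow> real) \<Rightarrow> 'a \<Rightarrow> 'a" where
  "prox \<gamma> \<phi> x = (ARG_MIN (\<lambda>z. \<phi> z + 1 / (2 * \<gamma>) * (norm (z - x))\<^sup>2) z. True)"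

(* The infimum is attained for convex continuous \<phi> and \<gamma> > 0, so it is the minimum there. *)
definition moreau_env :: "real \<Rightarrow> ('a::real_inner \<Rightarrow> real) \<Rightarrow> 'a \<Rightarrow> real" where
  "moreau_env \<gamma> \<phi> x = (INF z. \<phi> z + 1 / (2 * \<gamma>) * (norm (z - x))\<^sup>2)"

definition avg_fun :: "nat \<Rightarrow> (nat \<Rightarrow> 'a \<Rightarrow> real) \<Rightarrow> 'a \<Rightarrow> real" where
  "avg_fun n f x = (1 / real n) * (\<Sum>i\<in>{1..n}. f i x)"

definition L_gamma_tau :: "nat \<Rightarrow> nat \<Rightarrow> real \<Rightarrow> real \<Rightarrow> real \<Rightarrow> real" where
  "L_gamma_tau n \<tau> \<gamma> Lmax L\<gamma> =
     (real n - real \<tau>) / (real \<tau> * (real n - 1)) * (Lmax / (1 + \<gamma> * Lmax))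
     + real n * (real \<tau> - 1) / (real \<tau> * (real n - 1)) * L\<gamma>"

definition conv_const :: "nat \<Rightarrow> real \<Rightarrow> real \<Rightarrow> nat \<Rightarrow> real \<Rightarrow> real \<Rightarrow> real" where
  "conv_const n Lmax L\<gamma> \<tau> \<gamma> \<alpha> =
     (1 + \<gamma> * Lmax) / (\<alpha> * \<gamma> * (2 - \<alpha> * \<gamma> * L_gamma_tau n \<tau> \<gamma> Lmax L\<gamma>))"

definition tau_subsets :: "nat \<Rightarrow> nat \<Rightarrow> nat set set" where
  "tau_subsets n \<tau> = {A. A \<subseteq> {1..n} \<and> card A = \<tau>}"

(* The iterates along one realization S of the sampled index sets. *)
primrec fedexprox ::
  "(nat \<Rightarrow> 'a::real_inner \<Rightarrow> real) \<Rightarrow> nat \<Rightarrow> real \<Rightarrow> (nat \<Rightarrow> real) \<Rightarrow> 'a \<Rightarrow> (nat \<Rightarrow> nat set) \<Rightarrow> nat \<Rightarrow> 'a"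
where
  "fedexprox f \<tau> \<gamma> \<alpha> x0 S 0 = x0"
| "fedexprox f \<tau> \<gamma> \<alpha> x0 S (Suc k) =
     fedexprox f \<tau> \<gamma> \<alpha> x0 S k +
     \<alpha> k *\<^sub>R ((1 / real \<tau>) *\<^sub>R (\<Sum>i\<in>S k. prox \<gamma> (f i) (fedexprox f \<tau> \<gamma> \<alpha> x0 S k))
             - fedexprox f \<tau> \<gamma> \<alpha> x0 S k)"

(* Independent uniform \<tau>-subsets of {1..n}.  Measurability into the count space of the finite
   set of \<tau>-subsets makes every function of S 0, ..., S (K - 1) measurable with finite range, so
   Bochner expectations of such functions are never the default value of a non-integrable one. *)
definition nice_sampling ::
  "'w measure \<Rightarrow> nat \<Rightarrow> nat \<Rightarrow> nat \<Rightarrow> (nat \<Rightarrow> 'w \<Rightarrow> nat set) \<Rightarrow> bool"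
where
  "nice_sampling M n \<tau> K S \<longleftrightarrow>
     prob_space.indep_vars M (\<lambda>_. count_space (tau_subsets n \<tau>)) S {..<K} \<and>
     (\<forall>k<K. distr M (count_space (tau_subsets n \<tau>)) (S k) = uniform_count_measure (tau_subsets n \<tau>))"

(* The index of the returned iterate: uniform on {0, ..., K - 1} and independent of the joint
   sampling, hence of all iterates.  The library's indep_var needs both variables to have the same
   type, so independence of the two generated sigma-algebras is written out. *)
definition uniform_index ::
  "'w measure \<Rightarrow> nat \<Rightarrow> nat \<Rightarrow> nat \<Rightarrow> (nat \<Rightarrow> 'w \<Rightarrow> nat set) \<Rightarrow> ('w \<Rightarrow> nat) \<Rightarrow> bool"
where
  "uniform_index M n \<tau> K S J \<longleftrightarrow>
     J \<in> measurable M (count_space {..<K}) \<and>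
     distr M (count_space {..<K}) J = uniform_count_measure {..<K} \<and>
     prob_space.indep_set M
       {J -` A \<inter> space M | A. A \<in> sets (count_space {..<K})}
       {(\<lambda>\<omega>. \<lambda>k\<in>{..<K}. S k \<omega>) -` B \<inter> space M | B.
          B \<in> sets (Pi\<^sub>M {..<K} (\<lambda>_. count_space (tau_subsets n \<tau>)))}"

end

theory Submission
  imports Defs
begin

text \<open>
  The residual \<open>g\<^sub>i(x) = (x - prox \<gamma> f\<^sub>i x) / \<gamma>\<close> is the gradient of \<open>f\<^sub>i\<close> at the proximal point and also
  the gradient of the Moreau envelope of \<open>f\<^sub>i\<close> at \<open>x\<close>, so a step of the method is a minibatch
  gradient step on the average envelope with step size \<open>\<alpha>\<gamma>\<close>. At a common minimizer all residuals
  vanish, and cocoercivity bounds \<open>\<parallel>g\<^sub>i\<parallel>\<^sup>2\<close> and the squared norm of the mean residual by multiples of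
  inner products with \<open>x - x\<^sub>\<star>\<close>. Hence the expected squared distance to \<open>x\<^sub>\<star>\<close> decreases by at least
  \<open>\<alpha>\<gamma>(2 - \<alpha>\<gamma>L)\<close> times \<open>\<langle>mean residual, x - x\<^sub>\<star>\<rangle>\<close> with \<open>L = L_gamma_tau\<close>. This inner product dominates
  the envelope gap, which in turn is at least \<open>1 / (1 + \<gamma> Lmax)\<close> times the gap of \<open>f\<close>; summing over
  the iterations gives the rate.
\<close>

subsection \<open>Gradients of smooth convex functions\<close>

lemma GDERIV_unique:
  assumes "GDERIV f x :> a" "GDERIV f x :> b"
  shows "a = b"
proof -
  have "(\<lambda>h. inner h a) = (\<lambda>h. inner h b)"
    using assms unfolding gderiv_def by (rule has_derivative_unique)
  then have "inner (a - b) (a - b) = 0"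
    by (simp add: fun_eq_iff inner_diff_right)
  then show ?thesis by simp
qed

lemma GDERIV_gradient_eq: "GDERIV f x :> g \<Longrightarrow> gradient f x = g"
  unfolding gradient_def by (rule the_equality) (auto intro: GDERIV_unique)

text \<open>Riesz representation in coordinates: the vector of the derivative's values on
  \<open>Basis\<close> represents it. This makes the definite description behind
  \<open>gradient\<close> denote.\<close>

lemma GDERIV_gradient:
  fixes f :: "'a::euclidean_space \<Rightarrow> real"
  assumes "f differentiable (at x)"
  shows "GDERIV f x :> gradient f x"
proof -
  obtain f' where f': "(f has_derivative f') (at x)"
    using assms by (auto simp: differentiable_def)
  interpret bounded_linear f' using f' by (rule has_derivative_bounded_linear)
  define g where "g = (\<Sum>b\<in>Basis. f' b *\<^sub>R b)"
  have "f' h = inner h g" for h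
  proof -
    have "f' h = f' (\<Sum>b\<in>Basis. inner h b *\<^sub>R b)"
      by (simp add: euclidean_representation)
    also have "\<dots> = inner h g"
      by (simp add: g_def sum scaleR inner_sum_right mult.commute)
    finally show ?thesis .
  qed
  then have "f' = (\<lambda>h. inner h g)" by (rule ext)
  then have g: "GDERIV f x :> g"
    using f' by (simp only: gderiv_def)
  then show ?thesis
    by (simp only: GDERIV_gradient_eq[OF g])
qed

lemma GDERIV_minimum_eq_0:
  assumes "GDERIV f x :> g" "\<And>y. f x \<le> f y"
  shows "g = 0"
proof -
  have "(\<lambda>h. inner h g) = (\<lambda>v. 0)"
    using assms by (intro differential_zero_maxmin[of x UNIV f]) (auto simp: gderiv_def)
  then show ?thesis by (metis inner_eq_zero_iff)
qed

text \<open>Subtracting the linear function \<open>inner s\<close> turns the subgradient inequality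
  into minimality at \<open>x\<close>, where the gradient vanishes. A gradient can thus be read off
  from a subgradient inequality.\<close>

lemma GDERIV_subgradient_eq:
  assumes "GDERIV f x :> g" "\<And>y. f x + inner s (y - x) \<le> f y"
  shows "g = s"
proof -
  have "GDERIV (\<lambda>y. f y - inner s y) x :> g - s"
    using assms(1) unfolding gderiv_def
    by (auto intro!: derivative_eq_intros simp: inner_diff_right inner_commute)
  then have "g - s = 0"
  proof (rule GDERIV_minimum_eq_0)
    show "f x - inner s x \<le> f y - inner s y" for y
      using assms(2)[of y] by (simp add: inner_diff_right)
  qed
  then show ?thesis by simp
qed

text \<open>Restriction to the line through \<open>x\<close> and \<open>y\<close> reduces the claim
  to the tangent inequality for a convex function of one real variable.\<close>

lemma convex_on_above_gradient:
  fixes f :: "'a::euclidean_space \<Rightarrow> real"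
  assumes "convex_on UNIV f" "f differentiable (at x)"
  shows "f x + inner (gradient f x) (y - x) \<le> f y"
proof -
  let ?\<phi> = "\<lambda>t::real. f (x + t *\<^sub>R (y - x))"
  have "convex_on UNIV ?\<phi>"
  proof (rule convex_onI)
    fix t a b :: real assume t: "0 < t" "t < 1"
    have "x + ((1 - t) *\<^sub>R a + t *\<^sub>R b) *\<^sub>R (y - x)
        = (1 - t) *\<^sub>R (x + a *\<^sub>R (y - x)) + t *\<^sub>R (x + b *\<^sub>R (y - x))"
      by (simp add: algebra_simps)
    then show "?\<phi> ((1 - t) *\<^sub>R a + t *\<^sub>R b) \<le> (1 - t) * ?\<phi> a + t * ?\<phi> b"
      using convex_onD[OF assms(1), of t "x + a *\<^sub>R (y - x)" "x + b *\<^sub>R (y - x)"] t by simp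
  qed auto
  moreover have "(?\<phi> has_real_derivative inner (gradient f x) (y - x)) (at 0 within UNIV)"
  proof -
    have outer: "(f has_derivative (\<lambda>h. inner h (gradient f x))) (at (x + 0 *\<^sub>R (y - x)))"
      using GDERIV_gradient[OF assms(2)] by (simp add: gderiv_def)
    have inner: "((\<lambda>t. x + t *\<^sub>R (y - x)) has_derivative (\<lambda>t. t *\<^sub>R (y - x))) (at (0::real))"
      by (auto intro!: derivative_eq_intros)
    have "(?\<phi> has_derivative (\<lambda>t. inner (t *\<^sub>R (y - x)) (gradient f x))) (at 0)"
      by (rule has_derivative_compose[OF inner outer])
    then show ?thesis
      by (simp add: has_field_derivative_def inner_commute mult_commute_abs)
  qed
  ultimately have "?\<phi> 1 - ?\<phi> 0 \<ge> inner (gradient f x) (y - x) * (1 - 0)"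
    by (intro convex_on_imp_above_tangent[where A = UNIV]) auto
  then show ?thesis by simp
qed

text \<open>The lower bound at \<open>z = y - (G y - G x) / L\<close> is played off against the upper bound there.\<close>

lemma smooth_convex_lower_bound:
  fixes f :: "'a::real_inner \<Rightarrow> real"
  assumes "L > 0"
    and sub: "\<And>x y. f x + inner (G x) (y - x) \<le> f y"
    and smooth: "\<And>x y. f x - f y - inner (G y) (x - y) \<le> L / 2 * (norm (x - y))\<^sup>2"
  shows "f x + inner (G x) (y - x) + (norm (G x - G y))\<^sup>2 / (2 * L) \<le> f y"
proof -
  define w where "w = G x - G y"
  define z where "z = y + (1 / L) *\<^sub>R w"
  have "f x + inner (G x) (z - x) \<le> f z" by (rule sub)
  moreover have "f z - f y - inner (G y) (z - y) \<le> L / 2 * (norm (z - y))\<^sup>2" by (rule smooth)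
  moreover have "inner (G x) (z - x) = inner (G x) (y - x) + inner (G x) w / L"
    by (simp add: z_def algebra_simps inner_add_right inner_diff_right)
  moreover have "inner (G y) (z - y) = inner (G y) w / L"
    by (simp add: z_def)
  moreover have "L / 2 * (norm (z - y))\<^sup>2 = (norm w)\<^sup>2 / (2 * L)"
    using \<open>L > 0\<close> by (simp add: z_def power2_eq_square field_simps)
  moreover have "inner (G x) w / L - inner (G y) w / L = (norm w)\<^sup>2 / L"
    by (simp add: w_def power2_norm_eq_inner inner_diff_left diff_divide_distrib)
  moreover have "(norm w)\<^sup>2 / L - (norm w)\<^sup>2 / (2 * L) = (norm w)\<^sup>2 / (2 * L)"
    using \<open>L > 0\<close> by (simp add: field_simps)
  ultimately have "f x + inner (G x) (y - x) + (norm w)\<^sup>2 / (2 * L) \<le> f y" by linarith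
  then show ?thesis by (simp add: w_def)
qed

text \<open>The lower bound is added to its copy with \<open>x\<close> and \<open>y\<close>
  exchanged: the function values cancel and the two quadratic terms combine.\<close>

lemma smooth_convex_cocoercive:
  fixes f :: "'a::real_inner \<Rightarrow> real"
  assumes "L > 0"
    and "\<And>x y. f x + inner (G x) (y - x) \<le> f y"
    and "\<And>x y. f x - f y - inner (G y) (x - y) \<le> L / 2 * (norm (x - y))\<^sup>2"
  shows "(norm (G x - G y))\<^sup>2 \<le> L * inner (G x - G y) (x - y)"
proof -
  have "(norm (G x - G y))\<^sup>2 / (2 * L) + (norm (G x - G y))\<^sup>2 / (2 * L) \<le> inner (G x - G y) (x - y)"
    using smooth_convex_lower_bound[OF assms, of x y] smooth_convex_lower_bound[OF assms, of y x]
    by (simp add: norm_minus_commute algebra_simps inner_diff_right inner_diff_left)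
  then have "(norm (G x - G y))\<^sup>2 / L \<le> inner (G x - G y) (x - y)"
    by (simp add: field_simps)
  then show ?thesis using \<open>L > 0\<close> by (simp add: field_simps)
qed

subsection \<open>The proximal operator and the Moreau envelope\<close>

text \<open>\<open>prox\<close> is a Hilbert choice, so its minimality depends on some minimizer
  existing. The lower bound \<open>c\<close> makes the objective coercive, and compactness of a ball
  then supplies one.\<close>

lemma prox_minimizes_objective:
  fixes \<phi> :: "'a::euclidean_space \<Rightarrow> real"
  assumes "\<gamma> > 0" "continuous_on UNIV \<phi>" "\<And>z. c \<le> \<phi> z"
  shows "\<phi> (prox \<gamma> \<phi> x) + 1 / (2 * \<gamma>) * (norm (prox \<gamma> \<phi> x - x))\<^sup>2
       \<le> \<phi> z + 1 / (2 * \<gamma>) * (norm (z - x))\<^sup>2"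
proof -
  let ?h = "\<lambda>z. \<phi> z + 1 / (2 * \<gamma>) * (norm (z - x))\<^sup>2"
  \<comment> \<open>With this radius the quadratic term outside the ball is at least
    \<open>\<phi> x - c\<close>, so no point there beats the centre \<open>x\<close>.\<close>
  define r where "r = sqrt (2 * \<gamma> * (\<phi> x - c))"
  have r: "r \<ge> 0" "r\<^sup>2 = 2 * \<gamma> * (\<phi> x - c)"
    using assms by (auto simp: r_def)
  have "\<exists>p\<in>cball x r. \<forall>z\<in>cball x r. ?h p \<le> ?h z"
    using r \<open>\<gamma> > 0\<close> by (intro continuous_attains_inf)
      (auto intro!: continuous_intros continuous_on_subset[OF assms(2)])
  then obtain p where p: "\<And>z. z \<in> cball x r \<Longrightarrow> ?h p \<le> ?h z" by blast
  have "?h p \<le> ?h z" for z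
  proof (cases "z \<in> cball x r")
    case False
    then have "r\<^sup>2 \<le> (norm (z - x))\<^sup>2"
      using r by (intro power_mono) (auto simp: dist_norm norm_minus_commute)
    then have "\<phi> x - c \<le> 1 / (2 * \<gamma>) * (norm (z - x))\<^sup>2"
      using \<open>\<gamma> > 0\<close> r by (simp add: field_simps)
    then have "?h x \<le> ?h z" using assms(3)[of z] by simp
    then show ?thesis using p[of x] r by simp
  qed (use p in auto)
  then have "is_arg_min ?h (\<lambda>_. True) p" by (auto simp: is_arg_min_def not_less)
  then have "is_arg_min ?h (\<lambda>_. True) (prox \<gamma> \<phi> x)"
    unfolding prox_def arg_min_def by (rule someI)
  then show ?thesis by (auto simp: is_arg_min_def not_less)
qed

text \<open>One member of the family. By convexity the stationary point \<open>xs\<close> is a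
  global minimizer, which gives the lower bound that \<open>prox_minimizes_objective\<close> asks
  for.\<close>

locale smooth_convex_minimized =
  fixes f :: "'a::euclidean_space \<Rightarrow> real" and L \<gamma> :: real and xs :: 'a
  assumes convex: "convex_on UNIV f"
    and L_pos: "L > 0"
    and smooth: "L_smooth L f"
    and gradient_xs: "gradient f xs = 0"
    and \<gamma>_pos: "\<gamma> > 0"
begin

definition residual :: "'a \<Rightarrow> 'a" where
  "residual x = (1 / \<gamma>) *\<^sub>R (x - prox \<gamma> f x)"

lemma diff_f: "f differentiable (at x)"
  using smooth by (simp add: L_smooth_def)

lemma above_gradient: "f x + inner (gradient f x) (y - x) \<le> f y"
  using convex diff_f by (rule convex_on_above_gradient)

lemma minimum: "f xs \<le> f x"
  using above_gradient[of xs x] gradient_xs by simp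

lemma upper_bound: "f x - f y - inner (gradient f y) (x - y) \<le> L / 2 * (norm (x - y))\<^sup>2"
  using smooth by (simp add: L_smooth_def)

lemma prox_minimizes:
  "f (prox \<gamma> f x) + 1 / (2 * \<gamma>) * (norm (prox \<gamma> f x - x))\<^sup>2 \<le> f z + 1 / (2 * \<gamma>) * (norm (z - x))\<^sup>2"
proof (rule prox_minimizes_objective[OF \<gamma>_pos])
  show "continuous_on UNIV f"
    using diff_f by (auto intro!: continuous_at_imp_continuous_on differentiable_imp_continuous_within)
qed (rule minimum)

lemma prox_eq: "prox \<gamma> f x = x - \<gamma> *\<^sub>R residual x"
  using \<gamma>_pos by (simp add: residual_def)

text \<open>Fermat's rule for the objective defining \<open>prox\<close>: at its minimizer the
  gradient of the quadratic term is minus the residual.\<close>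

lemma gradient_prox: "gradient f (prox \<gamma> f x) = residual x"
proof -
  let ?p = "prox \<gamma> f x"
  have "(f has_derivative (\<lambda>h. inner h (gradient f ?p))) (at ?p)"
    using GDERIV_gradient[OF diff_f] by (simp add: gderiv_def)
  then have "GDERIV (\<lambda>z. f z + 1 / (2 * \<gamma>) * (norm (z - x))\<^sup>2) ?p
      :> gradient f ?p + (1 / \<gamma>) *\<^sub>R (?p - x)"
    using \<gamma>_pos unfolding gderiv_def power2_norm_eq_inner
    by (auto intro!: derivative_eq_intros simp: inner_add_right inner_commute fun_eq_iff)
  then have "gradient f ?p + (1 / \<gamma>) *\<^sub>R (?p - x) = 0"
    by (rule GDERIV_minimum_eq_0) (rule prox_minimizes)
  then show ?thesis
    by (simp add: residual_def algebra_simps eq_neg_iff_add_eq_0)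
qed

lemma moreau_env_eq: "moreau_env \<gamma> f x = f (prox \<gamma> f x) + \<gamma> / 2 * (norm (residual x))\<^sup>2"
proof -
  have "moreau_env \<gamma> f x = f (prox \<gamma> f x) + 1 / (2 * \<gamma>) * (norm (prox \<gamma> f x - x))\<^sup>2"
    unfolding moreau_env_def
    by (rule cInf_eq_minimum) (use prox_minimizes in auto)
  then show ?thesis
    using \<gamma>_pos by (simp add: prox_eq power2_eq_square)
qed

text \<open>The gradient inequality of \<open>f\<close> is used between the two proximal points.
  What remains after rewriting them through the residuals is the square \<gamma>/2 * |?a -
  ?b|^2.\<close>

lemma moreau_env_subgradient:
  "moreau_env \<gamma> f x + inner (residual x) (y - x) \<le> moreau_env \<gamma> f y"
proof -
  let ?a = "residual x" and ?b = "residual y"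
  have "f (prox \<gamma> f x) + inner ?a (prox \<gamma> f y - prox \<gamma> f x) \<le> f (prox \<gamma> f y)"
    using above_gradient[of "prox \<gamma> f x" "prox \<gamma> f y"] by (simp add: gradient_prox)
  moreover have "inner ?a (prox \<gamma> f y - prox \<gamma> f x)
      = inner ?a (y - x) + \<gamma> * (norm ?a)\<^sup>2 - \<gamma> * inner ?a ?b"
    by (simp add: prox_eq power2_norm_eq_inner algebra_simps inner_diff_right inner_add_right)
  moreover have "\<gamma> / 2 * (norm (?a - ?b))\<^sup>2
      = \<gamma> / 2 * (norm ?a)\<^sup>2 + \<gamma> / 2 * (norm ?b)\<^sup>2 - \<gamma> * inner ?a ?b"
    unfolding power2_norm_eq_inner
    by (simp add: inner_diff_right inner_diff_left inner_commute field_simps)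
  moreover have "0 \<le> \<gamma> / 2 * (norm (?a - ?b))\<^sup>2" using \<gamma>_pos by simp
  ultimately show ?thesis by (simp add: moreau_env_eq)
qed

lemma gradient_bound: "(norm (gradient f x))\<^sup>2 / (2 * L) \<le> f x - f xs"
  using smooth_convex_lower_bound[OF L_pos above_gradient upper_bound, of xs x]
  by (simp add: gradient_xs)

text \<open>Cocoercivity of the gradient of \<open>f\<close> is applied at the proximal point.
  Replacing that point by \<open>x\<close> minus \<gamma> times the residual releases a multiple of
  the squared residual, and moving it to the left produces the factor 1 + \<gamma>L.\<close>

lemma residual_cocoercive:
  "(norm (residual x))\<^sup>2 \<le> L / (1 + \<gamma> * L) * inner (residual x) (x - xs)"
proof -
  let ?g = "residual x"
  have "(norm ?g)\<^sup>2 \<le> L * inner ?g (prox \<gamma> f x - xs)"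
    using smooth_convex_cocoercive[OF L_pos above_gradient upper_bound, of "prox \<gamma> f x" xs]
    by (simp add: gradient_xs gradient_prox)
  also have "\<dots> = L * inner ?g (x - xs) - L * \<gamma> * (norm ?g)\<^sup>2"
    by (simp add: prox_eq power2_norm_eq_inner algebra_simps inner_diff_right)
  finally have "(1 + \<gamma> * L) * (norm ?g)\<^sup>2 \<le> L * inner ?g (x - xs)"
    by (simp add: algebra_simps)
  moreover have "1 + \<gamma> * L > 0" using \<gamma>_pos L_pos by (simp add: add_pos_pos)
  ultimately show ?thesis by (simp add: field_simps)
qed

lemma residual_xs: "residual xs = 0"
  using residual_cocoercive[of xs] by simp

lemma moreau_env_xs: "moreau_env \<gamma> f xs = f xs"
  by (simp add: moreau_env_eq prox_eq residual_xs)

text \<open>Smoothness bounds the rise of \<open>f\<close> from the proximal point to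
  \<open>x\<close> by (\<gamma> + L\<gamma>^2/2) |?g|^2. Half of \<gamma>|?g|^2 is already part of
  the envelope; the other half is paid for by \<open>gradient_bound\<close> at the proximal
  point.\<close>

lemma moreau_env_gap: "f x - f xs \<le> (1 + \<gamma> * L) * (moreau_env \<gamma> f x - moreau_env \<gamma> f xs)"
proof -
  let ?g = "residual x" and ?p = "prox \<gamma> f x"
  have "f x - f ?p \<le> \<gamma> * (norm ?g)\<^sup>2 + L / 2 * \<gamma>\<^sup>2 * (norm ?g)\<^sup>2"
    using upper_bound[of x ?p] \<gamma>_pos
    by (simp add: gradient_prox) (simp add: prox_eq power_mult_distrib power2_norm_eq_inner)
  moreover have "(norm ?g)\<^sup>2 * \<gamma> / 2 \<le> \<gamma> * L * (f ?p - f xs)"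
  proof -
    have "(norm ?g)\<^sup>2 / (2 * L) * (\<gamma> * L) \<le> (f ?p - f xs) * (\<gamma> * L)"
      using gradient_bound[of ?p] \<gamma>_pos L_pos by (intro mult_right_mono) (auto simp: gradient_prox)
    then show ?thesis using L_pos by (simp add: mult.commute)
  qed
  moreover have "(1 + \<gamma> * L) * (f ?p + \<gamma> / 2 * (norm ?g)\<^sup>2 - f xs)
      = f ?p - f xs + \<gamma> / 2 * (norm ?g)\<^sup>2 + \<gamma> * L * (f ?p - f xs) + L / 2 * \<gamma>\<^sup>2 * (norm ?g)\<^sup>2"
    by (simp add: algebra_simps power2_eq_square)
  moreover have "(norm ?g)\<^sup>2 * \<gamma> / 2 = \<gamma> / 2 * (norm ?g)\<^sup>2" by simp
  moreover have "\<gamma> * (norm ?g)\<^sup>2 = \<gamma> / 2 * (norm ?g)\<^sup>2 + \<gamma> / 2 * (norm ?g)\<^sup>2" by simp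
  ultimately show ?thesis
    unfolding moreau_env_xs moreau_env_eq[of x] by linarith
qed

end

subsection \<open>Moments of a uniformly random subset of given size\<close>

text \<open>Generalizes \<open>tau_subsets\<close> to an arbitrary ground set, because the counting
  below passes from \<open>U\<close> to \<open>U - {i}\<close>.\<close>

definition k_subsets :: "'b set \<Rightarrow> nat \<Rightarrow> 'b set set" where
  "k_subsets U k = {A. A \<subseteq> U \<and> card A = k}"

lemma finite_k_subsets: "finite U \<Longrightarrow> finite (k_subsets U k)"
  by (rule finite_subset[of _ "Pow U"]) (auto simp: k_subsets_def)

lemma card_k_subsets: "finite U \<Longrightarrow> card (k_subsets U k) = card U choose k"
  by (simp add: k_subsets_def n_subsets)

text \<open>Removing \<open>i\<close> leaves a subset of \<open>U - {i}\<close> with one element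
  less; the absorption identity for binomial coefficients does the rest. The product form keeps the
  inclusion probability k/|U| within the natural numbers.\<close>

lemma card_k_subsets_containing:
  assumes "finite U" "i \<in> U"
  shows "card U * card {A \<in> k_subsets U k. i \<in> A} = k * card (k_subsets U k)"
proof (cases k)
  case 0
  then have "{A \<in> k_subsets U k. i \<in> A} = {}"
    using assms by (auto simp: k_subsets_def dest: finite_subset)
  then show ?thesis using 0 by (simp only: card.empty)
next
  case (Suc l)
  obtain m where m: "card U = Suc m"
    using assms by (metis card_Suc_Diff1)
  have "{A \<in> k_subsets U k. i \<in> A} = insert i ` k_subsets (U - {i}) l"
  proof (intro equalityI subsetI)
    fix A assume "A \<in> {A \<in> k_subsets U k. i \<in> A}"
    then have A: "A \<subseteq> U" "card A = k" "i \<in> A" by (auto simp: k_subsets_def)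
    then have "A - {i} \<in> k_subsets (U - {i}) l"
      using Suc by (auto simp: k_subsets_def)
    moreover have "A = insert i (A - {i})" using A by auto
    ultimately show "A \<in> insert i ` k_subsets (U - {i}) l" by blast
  next
    fix A assume "A \<in> insert i ` k_subsets (U - {i}) l"
    then obtain B where B: "A = insert i B" "B \<subseteq> U - {i}" "card B = l"
      by (auto simp: k_subsets_def)
    moreover have "finite B" using B assms finite_subset by blast
    ultimately show "A \<in> {A \<in> k_subsets U k. i \<in> A}"
      using assms Suc by (auto simp: k_subsets_def card_insert_if)
  qed
  moreover have "inj_on (insert i) (k_subsets (U - {i}) l)"
    by (rule inj_onI) (auto simp: k_subsets_def)
  ultimately have "card {A \<in> k_subsets U k. i \<in> A} = m choose l"
    using assms m by (simp add: card_image card_k_subsets)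
  then show ?thesis
    using Suc_times_binomial[of l m] assms m Suc by (simp add: card_k_subsets)
qed

lemma card_k_subsets_containing2:
  assumes "finite U" "i \<in> U" "j \<in> U" "i \<noteq> j"
  shows "card U * (card U - 1) * card {A \<in> k_subsets U k. i \<in> A \<and> j \<in> A}
       = k * (k - 1) * card (k_subsets U k)"
proof (cases k)
  case 0
  then have "{A \<in> k_subsets U k. i \<in> A \<and> j \<in> A} = {}"
    using assms by (auto simp: k_subsets_def dest: finite_subset)
  then show ?thesis using 0 by (simp only: card.empty)
next
  case (Suc l)
  \<comment> \<open>The free predicate \<open>Q\<close> lets one bijection serve twice: with the
    condition that \<open>j\<close> remains, and with no condition at all.\<close>
  have remove: "card {A \<in> k_subsets U k. i \<in> A \<and> Q (A - {i})} = card {B \<in> k_subsets (U - {i}) l. Q B}"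
    for Q
  proof (rule bij_betw_same_card[of "\<lambda>A. A - {i}"], rule bij_betw_byWitness[where f' = "insert i"])
    show "insert i ` {B \<in> k_subsets (U - {i}) l. Q B} \<subseteq> {A \<in> k_subsets U k. i \<in> A \<and> Q (A - {i})}"
    proof clarify
      fix B assume B: "B \<in> k_subsets (U - {i}) l" "Q B"
      then have "finite B" "i \<notin> B" using assms(1) by (auto simp: k_subsets_def dest: finite_subset)
      then show "insert i B \<in> k_subsets U k \<and> i \<in> insert i B \<and> Q (insert i B - {i})"
        using B assms(2) Suc by (auto simp: k_subsets_def)
    qed
  qed (use Suc in \<open>auto simp: k_subsets_def\<close>)
  have "card {A \<in> k_subsets U k. i \<in> A \<and> j \<in> A - {i}} = card {B \<in> k_subsets (U - {i}) l. j \<in> B}"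
    by (rule remove)
  moreover have "card {A \<in> k_subsets U k. i \<in> A} = card (k_subsets (U - {i}) l)"
    using remove[of "\<lambda>_. True"] by simp
  moreover have "card (U - {i}) * card {B \<in> k_subsets (U - {i}) l. j \<in> B}
      = l * card (k_subsets (U - {i}) l)"
    using assms by (intro card_k_subsets_containing) auto
  moreover have "card U * card {A \<in> k_subsets U k. i \<in> A} = k * card (k_subsets U k)"
    using assms by (intro card_k_subsets_containing) auto
  ultimately have "card U * (card U - 1) * card {A \<in> k_subsets U k. i \<in> A \<and> j \<in> A - {i}}
      = l * (k * card (k_subsets U k))"
    using assms by (metis (no_types, lifting) card_Diff_singleton mult.assoc mult.left_commute)
  then show ?thesis using assms(4) Suc by (simp add: algebra_simps)
qed

text \<open>Double counting: after exchanging the sums, each \<open>h i\<close> is counted once for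
  every subset containing \<open>i\<close>. Vector values allow its use both for the residuals and
  for their squared norms.\<close>

lemma sum_k_subsets_sum:
  fixes h :: "'b \<Rightarrow> 'a::real_vector"
  assumes "finite U"
  shows "real (card U) *\<^sub>R (\<Sum>A\<in>k_subsets U k. \<Sum>i\<in>A. h i)
       = (real k * real (card (k_subsets U k))) *\<^sub>R (\<Sum>i\<in>U. h i)"
proof -
  have "(\<Sum>A\<in>k_subsets U k. \<Sum>i\<in>A. h i) = (\<Sum>A\<in>k_subsets U k. \<Sum>i\<in>{i\<in>U. i \<in> A}. h i)"
    by (intro sum.cong refl) (auto simp: k_subsets_def)
  also have "\<dots> = (\<Sum>i\<in>U. \<Sum>A\<in>{A \<in> k_subsets U k. i \<in> A}. h i)"
    using assms by (intro sum.swap_restrict finite_k_subsets)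
  also have "real (card U) *\<^sub>R \<dots>
      = (\<Sum>i\<in>U. real (card U * card {A \<in> k_subsets U k. i \<in> A}) *\<^sub>R h i)"
    by (simp add: scaleR_right.sum sum_constant_scaleR)
  also have "\<dots> = (\<Sum>i\<in>U. real (k * card (k_subsets U k)) *\<^sub>R h i)"
    using assms by (intro sum.cong refl) (simp only: card_k_subsets_containing)
  finally show ?thesis by (simp add: scaleR_right.sum)
qed

text \<open>Second moment of sampling without replacement. The square is split into diagonal and
  off-diagonal terms: an index is drawn with probability k/n, an ordered pair of distinct indices
  with probability k(k-1)/(n(n-1)).\<close>

lemma sum_k_subsets_norm_sum:
  fixes g :: "'b \<Rightarrow> 'a::real_inner"
  assumes "finite U" "card U \<ge> 2" "k \<ge> 1"
  defines "n \<equiv> real (card U)" and "N \<equiv> real (card (k_subsets U k))"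
  shows "n * (n - 1) * (\<Sum>A\<in>k_subsets U k. (norm (\<Sum>i\<in>A. g i))\<^sup>2)
       = N * (real k * (n - real k) * (\<Sum>i\<in>U. (norm (g i))\<^sup>2)
              + real k * (real k - 1) * (norm (\<Sum>i\<in>U. g i))\<^sup>2)"
proof -
  let ?T = "k_subsets U k"
  \<comment> \<open>Zero on the diagonal, so that the sums over distinct pairs can run over full
    squares.\<close>
  define c where "c i j = (if i = j then 0 else inner (g i) (g j))" for i j
  have expand: "(norm (\<Sum>i\<in>A. g i))\<^sup>2 = (\<Sum>i\<in>A. (norm (g i))\<^sup>2) + (\<Sum>i\<in>A. \<Sum>j\<in>A. c i j)"
    if "finite A" for A
  proof -
    have "(norm (\<Sum>i\<in>A. g i))\<^sup>2 = (\<Sum>i\<in>A. \<Sum>j\<in>A. inner (g i) (g j))"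
      unfolding power2_norm_eq_inner by (simp only: inner_sum_left inner_sum_right)
        (rule sum.swap)
    also have "\<dots> = (\<Sum>i\<in>A. \<Sum>j\<in>A. (if j = i then (norm (g i))\<^sup>2 else 0) + c i j)"
      by (intro sum.cong refl) (auto simp: c_def power2_norm_eq_inner)
    finally show ?thesis using that by (simp add: sum.distrib)
  qed
  have pairs: "n * (n - 1) * (\<Sum>A\<in>?T. \<Sum>i\<in>A. \<Sum>j\<in>A. c i j)
      = real k * (real k - 1) * N * (\<Sum>i\<in>U. \<Sum>j\<in>U. c i j)"
  proof -
    have "(\<Sum>A\<in>?T. \<Sum>i\<in>A. \<Sum>j\<in>A. c i j) = (\<Sum>A\<in>?T. \<Sum>p\<in>{p\<in>U \<times> U. p \<in> A \<times> A}. c (fst p) (snd p))"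
    proof (intro sum.cong refl)
      fix A assume "A \<in> ?T"
      then have "{p\<in>U \<times> U. p \<in> A \<times> A} = A \<times> A" by (auto simp: k_subsets_def)
      then show "(\<Sum>i\<in>A. \<Sum>j\<in>A. c i j) = (\<Sum>p\<in>{p\<in>U \<times> U. p \<in> A \<times> A}. c (fst p) (snd p))"
        by (simp add: sum.cartesian_product case_prod_unfold)
    qed
    also have "\<dots> = (\<Sum>p\<in>U \<times> U. \<Sum>A\<in>{A\<in>?T. p \<in> A \<times> A}. c (fst p) (snd p))"
      using assms by (intro sum.swap_restrict finite_k_subsets) auto
    also have "n * (n - 1) * \<dots>
        = (\<Sum>p\<in>U \<times> U. n * (n - 1) * real (card {A\<in>?T. p \<in> A \<times> A}) * c (fst p) (snd p))"
      by (simp add: sum_distrib_left mult.assoc)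
    also have "\<dots> = (\<Sum>p\<in>U \<times> U. real k * (real k - 1) * N * c (fst p) (snd p))"
    proof (intro sum.cong refl)
      fix p assume "p \<in> U \<times> U"
      then obtain i j where p: "p = (i, j)" "i \<in> U" "j \<in> U" by auto
      show "n * (n - 1) * real (card {A\<in>?T. p \<in> A \<times> A}) * c (fst p) (snd p)
          = real k * (real k - 1) * N * c (fst p) (snd p)"
      proof (cases "i = j")
        case False
        have "real (card U * (card U - 1) * card {A \<in> ?T. i \<in> A \<and> j \<in> A})
            = real (k * (k - 1) * card ?T)"
          using card_k_subsets_containing2[OF assms(1) p(2,3) False, of k] by (rule arg_cong)
        then show ?thesis
          using assms(2,3) by (simp add: p n_def N_def of_nat_diff)
      qed (simp add: p c_def)
    qed
    finally show ?thesis
      by (simp add: sum_distrib_left sum.cartesian_product case_prod_unfold)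
  qed
  have singles: "n * (\<Sum>A\<in>?T. \<Sum>i\<in>A. (norm (g i))\<^sup>2) = real k * N * (\<Sum>i\<in>U. (norm (g i))\<^sup>2)"
    using sum_k_subsets_sum[OF assms(1), of "\<lambda>i. (norm (g i))\<^sup>2" k] by (simp add: n_def N_def)
  have "(\<Sum>A\<in>?T. (norm (\<Sum>i\<in>A. g i))\<^sup>2)
      = (\<Sum>A\<in>?T. \<Sum>i\<in>A. (norm (g i))\<^sup>2) + (\<Sum>A\<in>?T. \<Sum>i\<in>A. \<Sum>j\<in>A. c i j)"
    unfolding sum.distrib[symmetric]
  proof (intro sum.cong refl)
    fix A assume "A \<in> ?T"
    then have "finite A" using assms(1) by (auto simp: k_subsets_def dest: finite_subset)
    then show "(norm (\<Sum>i\<in>A. g i))\<^sup>2 = (\<Sum>i\<in>A. (norm (g i))\<^sup>2 + (\<Sum>j\<in>A. c i j))"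
      by (simp add: expand sum.distrib)
  qed
  then have "n * (n - 1) * (\<Sum>A\<in>?T. (norm (\<Sum>i\<in>A. g i))\<^sup>2)
      = (n - 1) * (n * (\<Sum>A\<in>?T. \<Sum>i\<in>A. (norm (g i))\<^sup>2))
        + n * (n - 1) * (\<Sum>A\<in>?T. \<Sum>i\<in>A. \<Sum>j\<in>A. c i j)"
    by (simp add: algebra_simps)
  also have "\<dots> = N * (real k * (n - 1) * (\<Sum>i\<in>U. (norm (g i))\<^sup>2)
      + real k * (real k - 1) * (\<Sum>i\<in>U. \<Sum>j\<in>U. c i j))"
    unfolding singles pairs by (simp add: algebra_simps)
  \<comment> \<open>The same expansion on all of \<open>U\<close> eliminates the off-diagonal sum;
    the coefficient of the diagonal becomes (n-1) - (k-1) = n - k up to the factor k.\<close>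
  also have "(\<Sum>i\<in>U. \<Sum>j\<in>U. c i j) = (norm (\<Sum>i\<in>U. g i))\<^sup>2 - (\<Sum>i\<in>U. (norm (g i))\<^sup>2)"
    using expand[OF assms(1)] by simp
  finally show ?thesis by (simp add: algebra_simps)
qed

subsection \<open>One step of the method\<close>

locale interpolated_family =
  fixes n :: nat and f :: "nat \<Rightarrow> 'a::euclidean_space \<Rightarrow> real" and L :: "nat \<Rightarrow> real"
    and \<gamma> L\<gamma> Lmax :: real and xs :: 'a
  assumes n_ge_2: "n \<ge> 2"
    and members: "\<And>i. i \<in> {1..n} \<Longrightarrow> smooth_convex_minimized (f i) (L i) \<gamma> xs"
    and L_le_Lmax: "\<And>i. i \<in> {1..n} \<Longrightarrow> L i \<le> Lmax"
    and L\<gamma>_pos: "L\<gamma> > 0"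
    and envelope_smooth: "L_smooth L\<gamma> (avg_fun n (\<lambda>i. moreau_env \<gamma> (f i)))"
begin

abbreviation resid :: "nat \<Rightarrow> 'a \<Rightarrow> 'a" where
  "resid i \<equiv> smooth_convex_minimized.residual (f i) \<gamma>"

abbreviation envelope :: "'a \<Rightarrow> real" where
  "envelope \<equiv> avg_fun n (\<lambda>i. moreau_env \<gamma> (f i))"

definition mean_resid :: "'a \<Rightarrow> 'a" where
  "mean_resid x = (1 / real n) *\<^sub>R (\<Sum>i\<in>{1..n}. resid i x)"

lemma \<gamma>_pos: "\<gamma> > 0"
  using members[of 1] n_ge_2 by (auto simp: smooth_convex_minimized_def)

lemma Lmax_pos: "Lmax > 0"
  using members[of 1] L_le_Lmax[of 1] n_ge_2 by (auto simp: smooth_convex_minimized_def)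

lemma one_plus_pos: "1 + \<gamma> * Lmax > 0"
  using \<gamma>_pos Lmax_pos by (simp add: add_pos_pos)

lemma avg_minimum: "avg_fun n f xs \<le> avg_fun n f x"
  unfolding avg_fun_def
  by (intro mult_left_mono sum_mono) (auto intro: smooth_convex_minimized.minimum[OF members])

lemma Inf_avg: "(INF x. avg_fun n f x) = avg_fun n f xs"
  by (rule cInf_eq_minimum) (use avg_minimum in auto)

lemma inner_mean_resid:
  "inner (mean_resid x) y = (1 / real n) * (\<Sum>i\<in>{1..n}. inner (resid i x) y)"
  by (simp add: mean_resid_def inner_sum_left)

lemma envelope_subgradient: "envelope x + inner (mean_resid x) (y - x) \<le> envelope y"
proof -
  have "envelope x + inner (mean_resid x) (y - x)
      = (1 / real n) * (\<Sum>i\<in>{1..n}. moreau_env \<gamma> (f i) x + inner (resid i x) (y - x))"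
    by (simp only: avg_fun_def inner_mean_resid sum.distrib distrib_left)
  also have "\<dots> \<le> envelope y"
    unfolding avg_fun_def
    by (intro mult_left_mono sum_mono smooth_convex_minimized.moreau_env_subgradient[OF members]) auto
  finally show ?thesis .
qed

text \<open>\<open>L_smooth\<close> includes differentiability, and at a point of differentiability
  the only subgradient is the gradient.\<close>

lemma gradient_envelope: "gradient envelope x = mean_resid x"
proof (rule GDERIV_subgradient_eq)
  show "GDERIV envelope x :> gradient envelope x"
    using envelope_smooth by (intro GDERIV_gradient) (simp add: L_smooth_def)
qed (rule envelope_subgradient)

lemma mean_resid_xs: "mean_resid xs = 0"
  by (simp add: mean_resid_def smooth_convex_minimized.residual_xs[OF members])

text \<open>Cocoercivity is applied to the average envelope as a single function, which yields its
  own constant \<open>L\<gamma>\<close> instead of the individual ones.\<close>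

lemma mean_resid_cocoercive: "(norm (mean_resid x))\<^sup>2 \<le> L\<gamma> * inner (mean_resid x) (x - xs)"
proof -
  have "envelope x - envelope y - inner (mean_resid y) (x - y) \<le> L\<gamma> / 2 * (norm (x - y))\<^sup>2" for x y
    using envelope_smooth by (simp add: L_smooth_def gradient_envelope)
  from smooth_convex_cocoercive[where G = mean_resid, OF L\<gamma>_pos envelope_subgradient this, of x xs]
  show ?thesis by (simp add: mean_resid_xs)
qed

lemma mean_square_resid_bound:
  "(1 / real n) * (\<Sum>i\<in>{1..n}. (norm (resid i x))\<^sup>2)
   \<le> Lmax / (1 + \<gamma> * Lmax) * inner (mean_resid x) (x - xs)"
proof -
  have "(norm (resid i x))\<^sup>2 \<le> Lmax / (1 + \<gamma> * Lmax) * inner (resid i x) (x - xs)"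
    if i: "i \<in> {1..n}" for i
  proof -
    interpret smooth_convex_minimized "f i" "L i" \<gamma> xs using i by (rule members)
    have pos: "1 + \<gamma> * L i > 0" using \<gamma>_pos L_pos by (simp add: add_pos_pos)
    have coc: "(norm (residual x))\<^sup>2 \<le> L i / (1 + \<gamma> * L i) * inner (residual x) (x - xs)"
      by (rule residual_cocoercive)
    \<comment> \<open>The sign of the inner product is extracted first: only then may its factor be
      enlarged from \<open>L i\<close> to \<open>Lmax\<close>, using that t/(1 + \<gamma>t)
      increases in t.\<close>
    then have "0 \<le> L i / (1 + \<gamma> * L i) * inner (residual x) (x - xs)"
      by (rule order_trans[rotated]) simp
    moreover have "L i / (1 + \<gamma> * L i) > 0" using L_pos pos by simp
    ultimately have "0 \<le> inner (residual x) (x - xs)" by (simp only: zero_le_mult_iff) linarith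
    moreover have "L i / (1 + \<gamma> * L i) \<le> Lmax / (1 + \<gamma> * Lmax)"
      using pos one_plus_pos L_le_Lmax[OF i] by (simp add: field_simps)
    ultimately show ?thesis using coc by (meson mult_right_mono order_trans)
  qed
  then have "(1 / real n) * (\<Sum>i\<in>{1..n}. (norm (resid i x))\<^sup>2)
      \<le> (1 / real n) * (\<Sum>i\<in>{1..n}. Lmax / (1 + \<gamma> * Lmax) * inner (resid i x) (x - xs))"
    by (intro mult_left_mono sum_mono) auto
  also have "\<dots> = Lmax / (1 + \<gamma> * Lmax) * inner (mean_resid x) (x - xs)"
    unfolding inner_mean_resid by (simp add: sum_distrib_left mult_ac)
  finally show ?thesis .
qed

text \<open>The envelope serves as intermediary: \<open>moreau_env_gap\<close> passes from the
  function gap to the envelope gap, and the subgradient inequality at \<open>x\<close>, tested at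
  \<open>xs\<close>, bounds the latter by the inner product.\<close>

lemma avg_gap: "avg_fun n f x - avg_fun n f xs \<le> (1 + \<gamma> * Lmax) * inner (mean_resid x) (x - xs)"
proof -
  have "f i x - f i xs \<le> (1 + \<gamma> * Lmax) * (moreau_env \<gamma> (f i) x - moreau_env \<gamma> (f i) xs)"
    if i: "i \<in> {1..n}" for i
  proof -
    interpret smooth_convex_minimized "f i" "L i" \<gamma> xs using i by (rule members)
    have "moreau_env \<gamma> (f i) x - moreau_env \<gamma> (f i) xs \<ge> 0"
      using moreau_env_subgradient[of xs x] by (simp add: residual_xs)
    then have "(1 + \<gamma> * L i) * (moreau_env \<gamma> (f i) x - moreau_env \<gamma> (f i) xs)
        \<le> (1 + \<gamma> * Lmax) * (moreau_env \<gamma> (f i) x - moreau_env \<gamma> (f i) xs)"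
      using L_le_Lmax[OF i] \<gamma>_pos by (intro mult_right_mono) auto
    then show ?thesis using moreau_env_gap[of x] by linarith
  qed
  then have "(\<Sum>i\<in>{1..n}. f i x - f i xs)
      \<le> (\<Sum>i\<in>{1..n}. (1 + \<gamma> * Lmax) * (moreau_env \<gamma> (f i) x - moreau_env \<gamma> (f i) xs))"
    by (rule sum_mono)
  then have "(1 / real n) * (\<Sum>i\<in>{1..n}. f i x - f i xs)
      \<le> (1 / real n) * (\<Sum>i\<in>{1..n}. (1 + \<gamma> * Lmax) * (moreau_env \<gamma> (f i) x - moreau_env \<gamma> (f i) xs))"
    by (intro mult_left_mono) auto
  then have "avg_fun n f x - avg_fun n f xs \<le> (1 + \<gamma> * Lmax) * (envelope x - envelope xs)"
    by (simp add: avg_fun_def sum_subtractf sum_distrib_left[symmetric] right_diff_distrib mult.left_commute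
        diff_divide_distrib)
  also have "\<dots> \<le> (1 + \<gamma> * Lmax) * inner (mean_resid x) (x - xs)"
    using envelope_subgradient[of x xs] one_plus_pos
    by (intro mult_left_mono) (auto simp: inner_diff_right)
  finally show ?thesis .
qed

text \<open>The second moment of the sampled residual splits into the individual and the mean squared
  residuals; cocoercivity bounds both by the same inner product.\<close>

lemma one_step:
  assumes \<tau>: "1 \<le> \<tau>" "\<tau> \<le> n"
    and \<alpha>: "0 \<le> \<alpha>" "\<alpha> * \<gamma> * L_gamma_tau n \<tau> \<gamma> Lmax L\<gamma> \<le> 2"
  shows "(\<Sum>A\<in>tau_subsets n \<tau>.
        (norm (x + \<alpha> *\<^sub>R ((1 / real \<tau>) *\<^sub>R (\<Sum>i\<in>A. prox \<gamma> (f i) x) - x) - xs))\<^sup>2)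
    \<le> real (card (tau_subsets n \<tau>)) * ((norm (x - xs))\<^sup>2
        - \<alpha> * \<gamma> * (2 - \<alpha> * \<gamma> * L_gamma_tau n \<tau> \<gamma> Lmax L\<gamma>) / (1 + \<gamma> * Lmax)
          * (avg_fun n f x - avg_fun n f xs))"
proof -
  let ?T = "tau_subsets n \<tau>" and ?u = "x - xs" and ?s = "\<lambda>A. \<Sum>i\<in>A. resid i x"
  let ?V = "(1 / real n) * (\<Sum>i\<in>{1..n}. (norm (resid i x))\<^sup>2)"
  let ?W = "(norm (mean_resid x))\<^sup>2" and ?Q = "inner (mean_resid x) ?u"
  let ?L = "L_gamma_tau n \<tau> \<gamma> Lmax L\<gamma>"
  define step where "step A = x + \<alpha> *\<^sub>R ((1 / real \<tau>) *\<^sub>R (\<Sum>i\<in>A. prox \<gamma> (f i) x) - x)" for A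
  define N where "N = real (card ?T)"
  define t where "t = real \<tau>"
  define m where "m = real n"
  define c where "c = \<alpha> * \<gamma>"
  have t: "t \<ge> 1" "t \<le> m" and m: "m \<ge> 2"
    using \<tau> n_ge_2 by (auto simp: t_def m_def)
  have N: "N \<ge> 0" by (simp add: N_def)
  have c: "c \<ge> 0" "c * ?L \<le> 2" using \<alpha> \<gamma>_pos by (auto simp: c_def)
  have T: "?T = k_subsets {1..n} \<tau>" by (simp add: tau_subsets_def k_subsets_def)
  have n_mean: "(\<Sum>i\<in>{1..n}. resid i x) = m *\<^sub>R mean_resid x"
    using m by (simp add: mean_resid_def m_def)
  \<comment> \<open>The average of the proximal points is \<open>x\<close> minus \<gamma> times the
    average sampled residual, so \<open>x\<close> cancels and a minibatch gradient step of size
    \<open>c\<close> is left.\<close>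
  have step_eq: "step A - xs = ?u - (c / t) *\<^sub>R ?s A" if "A \<in> ?T" for A
  proof -
    have A: "A \<subseteq> {1..n}" "card A = \<tau>" using that by (auto simp: tau_subsets_def)
    have "(\<Sum>i\<in>A. prox \<gamma> (f i) x) = (\<Sum>i\<in>A. x - \<gamma> *\<^sub>R resid i x)"
      using A(1) by (intro sum.cong refl smooth_convex_minimized.prox_eq[OF members]) auto
    also have "\<dots> = t *\<^sub>R x - \<gamma> *\<^sub>R ?s A"
      using A(2) by (simp add: sum_subtractf scaleR_right.sum t_def sum_constant_scaleR)
    finally have prox_sum: "(\<Sum>i\<in>A. prox \<gamma> (f i) x) = t *\<^sub>R x - \<gamma> *\<^sub>R ?s A" .
    show ?thesis
      unfolding step_def t_def[symmetric] prox_sum using t by (simp add: c_def algebra_simps)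
  qed
  have first: "(\<Sum>A\<in>?T. ?s A) = (t * N) *\<^sub>R mean_resid x"
  proof -
    have eq: "m *\<^sub>R (\<Sum>A\<in>?T. ?s A) = m *\<^sub>R ((t * N) *\<^sub>R mean_resid x)"
      using sum_k_subsets_sum[of "{1..n}" "\<lambda>i. resid i x" \<tau>, OF finite_atLeastAtMost]
      unfolding n_mean by (simp add: T t_def m_def N_def mult_ac)
    show ?thesis
      by (rule scaleR_left_imp_eq[OF _ eq]) (use m in simp)
  qed
  have second: "(m - 1) * (\<Sum>A\<in>?T. (norm (?s A))\<^sup>2) = N * (t * (m - t) * ?V + t * (t - 1) * m * ?W)"
  proof -
    have "m * (m - 1) * (\<Sum>A\<in>?T. (norm (?s A))\<^sup>2)
        = N * (t * (m - t) * (m * ?V) + t * (t - 1) * (m\<^sup>2 * ?W))"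
      using sum_k_subsets_norm_sum[of "{1..n}" \<tau> "\<lambda>i. resid i x", unfolded n_mean] n_ge_2 \<tau>
      by (simp add: T t_def m_def N_def power_mult_distrib)
    also have "\<dots> = m * (N * (t * (m - t) * ?V + t * (t - 1) * m * ?W))"
      by (simp add: algebra_simps power2_eq_square)
    finally show ?thesis using m by (simp add: mult.assoc)
  qed
  \<comment> \<open>The mean squared norm of the minibatch residual \<open>?s A\<close> divided by
    \<open>t\<close>, as \<open>second'\<close> confirms. Its two coefficients are those of
    \<open>L_gamma_tau\<close>.\<close>
  define e where "e = (m - t) / (t * (m - 1)) * ?V + m * (t - 1) / (t * (m - 1)) * ?W"
  have "e \<le> (m - t) / (t * (m - 1)) * (Lmax / (1 + \<gamma> * Lmax) * ?Q) + m * (t - 1) / (t * (m - 1)) * (L\<gamma> * ?Q)"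
    unfolding e_def using t m
    by (intro add_mono mult_left_mono mean_square_resid_bound mean_resid_cocoercive) auto
  also have "\<dots> = ?L * ?Q"
    by (simp add: L_gamma_tau_def t_def m_def distrib_right mult.assoc)
  finally have e: "e \<le> ?L * ?Q" .
  have second': "(\<Sum>A\<in>?T. (norm (?s A))\<^sup>2) = N * t\<^sup>2 * e"
  proof -
    have "(m - 1) * (N * t\<^sup>2 * e) = N * (t * (m - t) * ?V + t * (t - 1) * m * ?W)"
      using t m unfolding e_def by (simp add: divide_simps) (simp add: algebra_simps power2_eq_square)
    with second have "(m - 1) * (\<Sum>A\<in>?T. (norm (?s A))\<^sup>2) = (m - 1) * (N * t\<^sup>2 * e)" by (simp only:)
    then show ?thesis using m by simp
  qed
  have "(\<Sum>A\<in>?T. (norm (step A - xs))\<^sup>2)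
      = (\<Sum>A\<in>?T. (norm ?u)\<^sup>2 - 2 * (c / t) * inner (?s A) ?u + (c / t)\<^sup>2 * (norm (?s A))\<^sup>2)"
    by (intro sum.cong refl, simp only: step_eq power2_norm_eq_inner)
      (simp add: inner_diff_left inner_diff_right inner_commute power2_eq_square algebra_simps)
  also have "\<dots> = N * (norm ?u)\<^sup>2 - 2 * (c / t) * inner (\<Sum>A\<in>?T. ?s A) ?u
      + (c / t)\<^sup>2 * (\<Sum>A\<in>?T. (norm (?s A))\<^sup>2)"
    by (simp only: sum.distrib sum_subtractf sum_distrib_left inner_sum_left sum_constant N_def)
  also have "\<dots> = N * ((norm ?u)\<^sup>2 - 2 * c * ?Q + c\<^sup>2 * e)"
    unfolding first second' using t by (simp add: power_divide algebra_simps)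
  also have "\<dots> \<le> N * ((norm ?u)\<^sup>2 - 2 * c * ?Q + c\<^sup>2 * (?L * ?Q))"
    using N e by (intro mult_left_mono add_left_mono) auto
  also have "\<dots> = N * ((norm ?u)\<^sup>2 - c * (2 - c * ?L) * ?Q)"
    by (simp add: algebra_simps power2_eq_square)
  \<comment> \<open>The restriction on \<alpha> makes \<open>c * (2 - c * ?L)\<close> nonnegative,
    so \<open>?Q\<close> may be replaced by its lower bound from \<open>avg_gap\<close>.\<close>
  also have "\<dots> \<le> N * ((norm ?u)\<^sup>2 - c * (2 - c * ?L) * ((avg_fun n f x - avg_fun n f xs) / (1 + \<gamma> * Lmax)))"
  proof (intro mult_left_mono[OF _ N] diff_left_mono mult_left_mono)
    show "(avg_fun n f x - avg_fun n f xs) / (1 + \<gamma> * Lmax) \<le> ?Q"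
      using avg_gap[of x] one_plus_pos by (simp add: pos_divide_le_eq mult.commute)
    show "0 \<le> c * (2 - c * ?L)" using c by simp
  qed
  finally show ?thesis by (simp add: N_def c_def step_def)
qed

end

subsection \<open>Averaging over all sampling paths\<close>

text \<open>A path of length \<open>Suc K\<close> is a path of length \<open>K\<close> together with
  the draw at index \<open>K\<close>.\<close>

lemma sum_PiE_lessThan_Suc:
  fixes F :: "(nat \<Rightarrow> 's) \<Rightarrow> 'b::comm_monoid_add"
  shows "(\<Sum>s\<in>{..<Suc K} \<rightarrow>\<^sub>E T. F s) = (\<Sum>s\<in>{..<K} \<rightarrow>\<^sub>E T. \<Sum>a\<in>T. F (s(K := a)))"
proof -
  have "(\<Sum>s\<in>{..<Suc K} \<rightarrow>\<^sub>E T. F s) = (\<Sum>p\<in>T \<times> ({..<K} \<rightarrow>\<^sub>E T). F ((snd p)(K := fst p)))"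
    unfolding lessThan_Suc PiE_insert_eq
    using inj_combinator[of K "{..<K}" "\<lambda>_. T"]
    by (subst sum.reindex) (simp_all add: case_prod_unfold)
  also have "\<dots> = (\<Sum>a\<in>T. \<Sum>s\<in>{..<K} \<rightarrow>\<^sub>E T. F (s(K := a)))"
    by (simp add: sum.cartesian_product case_prod_unfold)
  finally show ?thesis by (simp add: sum.swap[of _ T])
qed

text \<open>Finite sums over all paths take the place of conditional expectations. In the induction
  the inner sum over the last draw turns the one-step estimate into a telescoping bound.\<close>

lemma path_average_descent:
  fixes V G :: "'x \<Rightarrow> real" and X :: "(nat \<Rightarrow> 's) \<Rightarrow> nat \<Rightarrow> 'x"
  assumes init: "\<And>s. X s 0 = x0"
    and step: "\<And>s k. X s (Suc k) = h (X s k) (s k)"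
    and descent: "\<And>x. (\<Sum>a\<in>T. V (h x a)) \<le> real (card T) * (V x - G x)"
  shows "(\<Sum>s\<in>{..<K} \<rightarrow>\<^sub>E T. V (X s K) + (\<Sum>j<K. G (X s j))) \<le> real (card T) ^ K * V x0"
proof (induction K)
  case 0
  show ?case by (simp add: init)
next
  case (Suc K)
  \<comment> \<open>State \<open>j\<close> depends only on the draws with index below
    \<open>j\<close>, so changing draw \<open>K\<close> affects no state up to and including
    \<open>K\<close>.\<close>
  have past: "X (s(K := a)) j = X s j" if "j \<le> K" for s a j
    using that by (induction j) (simp_all add: init step)
  have "(\<Sum>s\<in>{..<Suc K} \<rightarrow>\<^sub>E T. V (X s (Suc K)) + (\<Sum>j<Suc K. G (X s j)))
      = (\<Sum>s\<in>{..<K} \<rightarrow>\<^sub>E T. (\<Sum>a\<in>T. V (h (X s K) a)) + real (card T) * (\<Sum>j<Suc K. G (X s j)))"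
    unfolding sum_PiE_lessThan_Suc by (simp add: step past sum.distrib)
  also have "\<dots> \<le> (\<Sum>s\<in>{..<K} \<rightarrow>\<^sub>E T.
      real (card T) * (V (X s K) - G (X s K)) + real (card T) * (\<Sum>j<Suc K. G (X s j)))"
    by (intro sum_mono add_right_mono descent)
  also have "\<dots> = real (card T) * (\<Sum>s\<in>{..<K} \<rightarrow>\<^sub>E T. V (X s K) + (\<Sum>j<K. G (X s j)))"
    by (simp add: sum_distrib_left[of "real (card T)" _ "{..<K} \<rightarrow>\<^sub>E T"] algebra_simps)
  also have "\<dots> \<le> real (card T) * (real (card T) ^ K * V x0)"
    by (intro mult_left_mono Suc.IH) auto
  finally show ?case by simp
qed

lemma (in prob_space) prob_uniform_distr:
  assumes "Y \<in> measurable M (count_space T)" "distr M (count_space T) Y = uniform_count_measure T"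
    and "finite T" "t \<in> T"
  shows "prob (Y -` {t} \<inter> space M) = 1 / real (card T)"
proof -
  have "prob (Y -` {t} \<inter> space M) = measure (distr M (count_space T) Y) {t}"
    using assms(1,4) by (simp add: measure_distr)
  also have "\<dots> = 1 / real (card T)"
    using assms by (simp add: measure_uniform_count_measure)
  finally show ?thesis .
qed

lemma finite_tau_subsets: "finite (tau_subsets n \<tau>)"
  unfolding tau_subsets_def by (rule finite_subset[of _ "Pow {1..n}"]) auto

text \<open>Independence makes the joint law of index and path uniform on a finite product, so the
  expectation is a plain average. Restricting the path to \<open>{..<K}\<close> places it in an
  extensional function space, where each single path is a measurable box.\<close>

lemma (in prob_space) expectation_sampling:
  fixes F :: "nat \<Rightarrow> (nat \<Rightarrow> nat set) \<Rightarrow> real"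
  assumes "nice_sampling M n \<tau> K S" "uniform_index M n \<tau> K S J" "K \<ge> 1"
  shows "expectation (\<lambda>\<omega>. F (J \<omega>) (\<lambda>k\<in>{..<K}. S k \<omega>))
    = (\<Sum>j<K. \<Sum>s\<in>{..<K} \<rightarrow>\<^sub>E tau_subsets n \<tau>. F j s) / (real K * real (card (tau_subsets n \<tau>)) ^ K)"
proof -
  let ?T = "tau_subsets n \<tau>"
  let ?R = "\<lambda>\<omega>. \<lambda>k\<in>{..<K}. S k \<omega>"
  let ?P = "{..<K} \<rightarrow>\<^sub>E ?T"
  define E where "E j s = (J -` {j} \<inter> space M) \<inter> (?R -` {s} \<inter> space M)" for j s
  have S: "indep_vars (\<lambda>_. count_space ?T) S {..<K}"
    and S_distr: "\<And>k. k < K \<Longrightarrow> distr M (count_space ?T) (S k) = uniform_count_measure ?T"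
    using assms(1) by (auto simp: nice_sampling_def)
  have S_meas: "S k \<in> measurable M (count_space ?T)" if "k < K" for k
    using S that by (auto simp: indep_vars_def)
  have J: "J \<in> measurable M (count_space {..<K})"
    "distr M (count_space {..<K}) J = uniform_count_measure {..<K}"
    and indep: "indep_set {J -` A \<inter> space M | A. A \<in> sets (count_space {..<K})}
       {?R -` B \<inter> space M | B. B \<in> sets (Pi\<^sub>M {..<K} (\<lambda>_. count_space ?T))}"
    using assms(2) by (auto simp: uniform_index_def)
  have J_event: "J -` {j} \<inter> space M \<in> {J -` A \<inter> space M | A. A \<in> sets (count_space {..<K})}"
    if "j < K" for j
    using that by auto
  have R_event: "?R -` {s} \<inter> space M \<in> {?R -` B \<inter> space M | B. B \<in> sets (Pi\<^sub>M {..<K} (\<lambda>_. count_space ?T))}"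
    if "s \<in> ?P" for s
  proof -
    have "{s} = (\<Pi>\<^sub>E k\<in>{..<K}. {s k})"
      by (rule PiE_singleton[symmetric]) (use that in \<open>simp add: PiE_def\<close>)
    also have "\<dots> \<in> sets (Pi\<^sub>M {..<K} (\<lambda>_. count_space ?T))"
      using that by (intro sets_PiM_I_finite) auto
    finally show ?thesis by blast
  qed
  have E_event: "E j s \<in> events" if "j < K" "s \<in> ?P" for j s
    unfolding E_def
    by (rule sets.Int[OF subsetD[OF indep_setD_ev1[OF indep] J_event[OF that(1)]]
          subsetD[OF indep_setD_ev2[OF indep] R_event[OF that(2)]]])
  have prob_E: "prob (E j s) = 1 / (real K * real (card ?T) ^ K)" if "j < K" "s \<in> ?P" for j s
  proof -
    have "?R -` {s} \<inter> space M = (\<Inter>k\<in>{..<K}. S k -` {s k} \<inter> space M)"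
      using that \<open>K \<ge> 1\<close> by (auto simp: fun_eq_iff PiE_def extensional_def restrict_def)
    also have "prob \<dots> = (\<Prod>k\<in>{..<K}. prob (S k -` {s k} \<inter> space M))"
      using that \<open>K \<ge> 1\<close> by (intro indep_varsD_finite[OF S]) (auto simp: lessThan_empty_iff)
    also have "\<dots> = (\<Prod>k\<in>{..<K}. 1 / real (card ?T))"
      using that by (intro prod.cong refl prob_uniform_distr[OF S_meas S_distr finite_tau_subsets]) auto
    finally have "prob (?R -` {s} \<inter> space M) = 1 / real (card ?T) ^ K"
      by (simp add: power_one_over)
    moreover have "prob (J -` {j} \<inter> space M) = 1 / real K"
      using prob_uniform_distr[OF J] that by simp
    moreover have "prob (E j s) = prob (J -` {j} \<inter> space M) * prob (?R -` {s} \<inter> space M)"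
      unfolding E_def by (rule indep_setD[OF indep J_event[OF that(1)] R_event[OF that(2)]])
    ultimately show ?thesis by simp
  qed
  \<comment> \<open>The events \<open>E j s\<close> partition the sample space, so for each \<omega>
    exactly one indicator survives.\<close>
  have "expectation (\<lambda>\<omega>. F (J \<omega>) (?R \<omega>))
      = expectation (\<lambda>\<omega>. \<Sum>j<K. \<Sum>s\<in>?P. F j s * indicator (E j s) \<omega>)"
  proof (rule Bochner_Integration.integral_cong[OF refl])
    fix \<omega> assume \<omega>: "\<omega> \<in> space M"
    have "J \<omega> < K" using measurable_space[OF J(1) \<omega>] by simp
    moreover have "?R \<omega> \<in> ?P" using measurable_space[OF S_meas \<omega>] by auto
    moreover have "indicator (E j s) \<omega> = (if s = ?R \<omega> then if j = J \<omega> then 1 else 0 else (0::real))" for j s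
      using \<omega> by (auto simp: E_def indicator_def)
    ultimately show "F (J \<omega>) (?R \<omega>) = (\<Sum>j<K. \<Sum>s\<in>?P. F j s * indicator (E j s) \<omega>)"
      by (simp add: if_distrib[of "times _"] finite_PiE finite_tau_subsets cong: if_cong)
  qed
  also have "\<dots> = (\<Sum>j<K. \<Sum>s\<in>?P. F j s * prob (E j s))"
    using E_event by (simp add: integral_sum integrable_sum less_top[symmetric])
  also have "\<dots> = (\<Sum>j<K. \<Sum>s\<in>?P. F j s) / (real K * real (card ?T) ^ K)"
    by (simp add: prob_E sum_divide_distrib)
  finally show ?thesis .
qed

subsection \<open>The convergence rate and the optimal extrapolation\<close>

text \<open>The two coefficients in \<open>L_gamma_tau\<close> are nonnegative and sum to 1, so the
  value lies between \<open>L\<gamma>\<close> and Lmax/(1 + \<gamma>Lmax). The upper end times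
  \<gamma> is below 1, which later makes the optimal extrapolation exceed 1.\<close>

lemma L_gamma_tau_bounds:
  assumes "n \<ge> 2" "1 \<le> \<tau>" "\<tau> \<le> n" "\<gamma> > 0" "Lmax > 0" "0 < L\<gamma>" "L\<gamma> \<le> Lmax / (1 + \<gamma> * Lmax)"
  shows "0 < L_gamma_tau n \<tau> \<gamma> Lmax L\<gamma>" "\<gamma> * L_gamma_tau n \<tau> \<gamma> Lmax L\<gamma> < 1"
proof -
  define a where "a = (real n - real \<tau>) / (real \<tau> * (real n - 1))"
  define b where "b = real n * (real \<tau> - 1) / (real \<tau> * (real n - 1))"
  let ?l = "Lmax / (1 + \<gamma> * Lmax)"
  have ab: "a \<ge> 0" "b \<ge> 0" using assms by (auto simp: a_def b_def)
  have "a + b = ((real n - real \<tau>) + real n * (real \<tau> - 1)) / (real \<tau> * (real n - 1))"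
    by (simp add: a_def b_def add_divide_distrib)
  also have "(real n - real \<tau>) + real n * (real \<tau> - 1) = real \<tau> * (real n - 1)"
    by (simp add: algebra_simps)
  finally have sum: "a + b = 1" using assms by simp
  have eq: "L_gamma_tau n \<tau> \<gamma> Lmax L\<gamma> = a * ?l + b * L\<gamma>"
    by (simp add: L_gamma_tau_def a_def b_def)
  have pos: "1 + \<gamma> * Lmax > 0" using assms by (simp add: add_pos_pos)
  have "L\<gamma> = a * L\<gamma> + b * L\<gamma>" using sum by (simp add: distrib_right[symmetric])
  also have "\<dots> \<le> a * ?l + b * L\<gamma>" using ab assms by (intro add_right_mono mult_left_mono)
  finally show "0 < L_gamma_tau n \<tau> \<gamma> Lmax L\<gamma>" using eq assms by linarith
  have "a * ?l + b * L\<gamma> \<le> a * ?l + b * ?l" using ab assms by (intro add_left_mono mult_left_mono)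
  also have "\<dots> = ?l" using sum by (simp only: distrib_right[symmetric] mult_1)
  finally have "\<gamma> * L_gamma_tau n \<tau> \<gamma> Lmax L\<gamma> \<le> \<gamma> * ?l"
    using assms unfolding eq by (intro mult_left_mono) auto
  also have "\<dots> < 1" using pos by simp
  finally show "\<gamma> * L_gamma_tau n \<tau> \<gamma> Lmax L\<gamma> < 1" .
qed

text \<open>Completing the square gives p * a * (2 - a * p) = 1 - (a * p - 1)^2, so the value
  \<open>A * p\<close> at \<open>1 / p\<close> is strictly smaller than at any other admissible
  point.\<close>

lemma is_arg_min_inverse_quadratic:
  fixes A p \<alpha> :: real
  assumes "A > 0" "p > 0"
  shows "is_arg_min (\<lambda>a. A / (a * (2 - a * p))) (\<lambda>a. a \<in> {0<..<2 / p}) \<alpha> \<longleftrightarrow> \<alpha> = 1 / p"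
proof -
  let ?C = "\<lambda>a. A / (a * (2 - a * p))"
  have C_opt: "?C (1 / p) = A * p" using assms by simp
  have less: "A * p < ?C a" if a: "a \<in> {0<..<2 / p}" "a \<noteq> 1 / p" for a
  proof -
    have "a * (2 - a * p) > 0" using a assms by (simp add: field_simps)
    moreover have "p * (a * (2 - a * p)) = 1 - (a * p - 1)\<^sup>2"
      by (simp add: power2_eq_square algebra_simps)
    moreover have "a * p - 1 \<noteq> 0" using a(2) assms by (simp add: field_simps)
    ultimately have "a * (2 - a * p) > 0" "p * (a * (2 - a * p)) < 1" by auto
    then show ?thesis using assms by (simp add: pos_less_divide_eq mult.assoc)
  qed
  have mem: "1 / p \<in> {0<..<2 / p}" using assms by (simp add: divide_strict_right_mono)
  show ?thesis
  proof
    assume *: "is_arg_min ?C (\<lambda>a. a \<in> {0<..<2 / p}) \<alpha>"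
    then have "\<alpha> \<in> {0<..<2 / p}" "\<not> ?C (1 / p) < ?C \<alpha>"
      using mem by (auto simp only: is_arg_min_def)
    then show "\<alpha> = 1 / p" using less unfolding C_opt by blast
  next
    assume \<alpha>: "\<alpha> = 1 / p"
    have "\<not> ?C a < ?C (1 / p)" if "a \<in> {0<..<2 / p}" for a
    proof (cases "a = 1 / p")
      case False
      then show ?thesis using less[OF that] unfolding C_opt by (blast intro: order.asym)
    qed simp
    then show "is_arg_min ?C (\<lambda>a. a \<in> {0<..<2 / p}) \<alpha>"
      using mem unfolding \<alpha> is_arg_min_def by blast
  qed
qed

lemma fedexprox_cong:
  "(\<And>i. i < k \<Longrightarrow> S i = S' i) \<Longrightarrow> fedexprox f \<tau> \<gamma> \<alpha> x0 S k = fedexprox f \<tau> \<gamma> \<alpha> x0 S' k"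
  by (induction k) auto

lemma (in interpolated_family) convergence:
  assumes \<tau>: "1 \<le> \<tau>" "\<tau> \<le> n" and "K \<ge> 1"
    and M: "prob_space M" "nice_sampling M n \<tau> K S" "uniform_index M n \<tau> K S J"
    and L_pos: "0 < L_gamma_tau n \<tau> \<gamma> Lmax L\<gamma>"
    and \<alpha>: "\<alpha> \<in> {0<..<2 / (\<gamma> * L_gamma_tau n \<tau> \<gamma> Lmax L\<gamma>)}"
  shows "prob_space.expectation M
      (\<lambda>\<omega>. avg_fun n f (fedexprox f \<tau> \<gamma> (\<lambda>_. \<alpha>) x0 (\<lambda>k. S k \<omega>) (J \<omega>))) - (INF x. avg_fun n f x)
    \<le> conv_const n Lmax L\<gamma> \<tau> \<gamma> \<alpha> * ((norm (x0 - xs))\<^sup>2 / real K)"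
proof -
  interpret prob_space M by (rule M(1))
  let ?T = "tau_subsets n \<tau>" and ?F = "avg_fun n f" and ?Lt = "L_gamma_tau n \<tau> \<gamma> Lmax L\<gamma>"
  let ?P = "{..<K} \<rightarrow>\<^sub>E ?T"
  define X where "X = fedexprox f \<tau> \<gamma> (\<lambda>_. \<alpha>) x0"
  define N where "N = real (card ?T)"
  \<comment> \<open>The guaranteed decrease of the mean squared distance per unit of function gap;
    its reciprocal is \<open>conv_const\<close>.\<close>
  define c where "c = \<alpha> * \<gamma> * (2 - \<alpha> * \<gamma> * ?Lt) / (1 + \<gamma> * Lmax)"
  define A where "A = (\<Sum>j<K. \<Sum>s\<in>?P. ?F (X s j))"
  have "card ?T = n choose \<tau>"
    unfolding tau_subsets_def by (simp add: n_subsets)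
  then have N: "N > 0" using \<tau> by (simp add: N_def)
  have small: "\<alpha> * \<gamma> * ?Lt < 2" and "\<alpha> > 0"
    using \<alpha> \<gamma>_pos L_pos by (auto simp: field_simps)
  have c: "c > 0"
    using small \<open>\<alpha> > 0\<close> \<gamma>_pos one_plus_pos by (simp add: c_def)
  have "(\<Sum>s\<in>?P. (norm (X s K - xs))\<^sup>2 + (\<Sum>j<K. c * (?F (X s j) - ?F xs)))
      \<le> N ^ K * (norm (x0 - xs))\<^sup>2"
    unfolding N_def
  proof (rule path_average_descent[where V = "\<lambda>x. (norm (x - xs))\<^sup>2" and G = "\<lambda>x. c * (?F x - ?F xs)"])
    show "(\<Sum>A\<in>?T. (norm (x + \<alpha> *\<^sub>R ((1 / real \<tau>) *\<^sub>R (\<Sum>i\<in>A. prox \<gamma> (f i) x) - x) - xs))\<^sup>2)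
        \<le> real (card ?T) * ((norm (x - xs))\<^sup>2 - c * (?F x - ?F xs))" for x
      unfolding c_def using \<tau> small \<open>\<alpha> > 0\<close> by (intro one_step) auto
  qed (simp_all add: X_def)
  moreover have "(\<Sum>s\<in>?P. \<Sum>j<K. c * (?F (X s j) - ?F xs)) = c * (A - real K * N ^ K * ?F xs)"
  proof -
    have "(\<Sum>s\<in>?P. \<Sum>j<K. c * (?F (X s j) - ?F xs)) = c * (\<Sum>s\<in>?P. \<Sum>j<K. ?F (X s j) - ?F xs)"
      by (simp only: sum_distrib_left)
    also have "(\<Sum>s\<in>?P. \<Sum>j<K. ?F (X s j) - ?F xs) = (\<Sum>s\<in>?P. \<Sum>j<K. ?F (X s j)) - real K * N ^ K * ?F xs"
      by (simp add: sum_subtractf card_PiE N_def)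
    also have "(\<Sum>s\<in>?P. \<Sum>j<K. ?F (X s j)) = A"
      unfolding A_def by (rule sum.swap)
    finally show ?thesis .
  qed
  \<comment> \<open>The squared distance after the last step is nonnegative and is dropped.\<close>
  ultimately have bound: "c * (A - real K * N ^ K * ?F xs) \<le> N ^ K * (norm (x0 - xs))\<^sup>2"
    using sum_nonneg[of ?P "\<lambda>s. (norm (X s K - xs))\<^sup>2"] by (simp add: sum.distrib)
  \<comment> \<open>The returned index is below \<open>K\<close>, so the iterate reads only draws
    that the restricted path retains.\<close>
  have "expectation (\<lambda>\<omega>. ?F (X (\<lambda>k. S k \<omega>) (J \<omega>)))
      = expectation (\<lambda>\<omega>. ?F (X (\<lambda>k\<in>{..<K}. S k \<omega>) (J \<omega>)))"
  proof (rule Bochner_Integration.integral_cong[OF refl])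
    fix \<omega> assume "\<omega> \<in> space M"
    then have "J \<omega> < K"
      using M(3) by (auto simp: uniform_index_def dest: measurable_space)
    then show "?F (X (\<lambda>k. S k \<omega>) (J \<omega>)) = ?F (X (\<lambda>k\<in>{..<K}. S k \<omega>) (J \<omega>))"
      unfolding X_def by (intro arg_cong[of _ _ ?F] fedexprox_cong) auto
  qed
  also have "\<dots> = A / (real K * N ^ K)"
    unfolding A_def N_def
    by (rule expectation_sampling[OF M(2,3) \<open>K \<ge> 1\<close>, where F = "\<lambda>j s. ?F (X s j)"])
  finally have "expectation (\<lambda>\<omega>. ?F (X (\<lambda>k. S k \<omega>) (J \<omega>))) - ?F xs
      = (A - real K * N ^ K * ?F xs) / (real K * N ^ K)"
    using N \<open>K \<ge> 1\<close> by (simp add: diff_divide_distrib)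
  also have "\<dots> \<le> (N ^ K * (norm (x0 - xs))\<^sup>2 / c) / (real K * N ^ K)"
    using bound c N by (intro divide_right_mono) (simp_all add: field_simps)
  also have "\<dots> = (1 / c) * ((norm (x0 - xs))\<^sup>2 / real K)"
    using N by simp
  also have "1 / c = conv_const n Lmax L\<gamma> \<tau> \<gamma> \<alpha>"
    by (simp add: c_def conv_const_def)
  finally show ?thesis by (simp add: X_def Inf_avg)
qed

theorem theorem1:
  fixes n \<tau> K :: nat
    and f :: "nat \<Rightarrow> real ^ 'd \<Rightarrow> real"
    and L :: "nat \<Rightarrow> real"
    and \<gamma> L\<gamma> Lmax :: real
    and x0 xstar :: "real ^ 'd"
    and M :: "'w measure"
    and S :: "nat \<Rightarrow> 'w \<Rightarrow> nat set"
    and J :: "'w \<Rightarrow> nat"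
  assumes "Lmax = Max (L ` {1..n})"
    and "n \<ge> 2" and "\<tau> \<in> {1..n}"
    and "\<And>i. i \<in> {1..n} \<Longrightarrow> convex_on UNIV (f i)"
    and "\<And>i. i \<in> {1..n} \<Longrightarrow> L i > 0"
    and "\<And>i. i \<in> {1..n} \<Longrightarrow> L_smooth (L i) (f i)"
    and "\<And>i. i \<in> {1..n} \<Longrightarrow> gradient (f i) xstar = 0"
    and "\<gamma> > 0"
    and "L\<gamma> > 0"
    and "L_smooth L\<gamma> (avg_fun n (\<lambda>i. moreau_env \<gamma> (f i)))"
    and "L\<gamma> \<le> (1 / real n) * (\<Sum>i\<in>{1..n}. L i / (1 + \<gamma> * L i))"
    and "K \<ge> 1"
    and "prob_space M"
    and "nice_sampling M n \<tau> K S"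
    and "uniform_index M n \<tau> K S J"
  shows
    "(\<forall>\<alpha>. \<alpha> \<in> {0<..<2 / (\<gamma> * L_gamma_tau n \<tau> \<gamma> Lmax L\<gamma>)} \<longrightarrow>
        prob_space.expectation M
          (\<lambda>\<omega>. avg_fun n f (fedexprox f \<tau> \<gamma> (\<lambda>_. \<alpha>) x0 (\<lambda>k. S k \<omega>) (J \<omega>)))
          - (INF x. avg_fun n f x)
        \<le> conv_const n Lmax L\<gamma> \<tau> \<gamma> \<alpha> * ((norm (x0 - xstar))\<^sup>2 / real K))
     \<and> (let \<alpha>opt = 1 / (\<gamma> * L_gamma_tau n \<tau> \<gamma> Lmax L\<gamma>) in
        (\<forall>\<alpha>. is_arg_min (conv_const n Lmax L\<gamma> \<tau> \<gamma>)
               (\<lambda>a. a \<in> {0<..<2 / (\<gamma> * L_gamma_tau n \<tau> \<gamma> Lmax L\<gamma>)}) \<alpha>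
             \<longleftrightarrow> \<alpha> = \<alpha>opt)
        \<and> \<alpha>opt > 1
        \<and> prob_space.expectation M
            (\<lambda>\<omega>. avg_fun n f (fedexprox f \<tau> \<gamma> (\<lambda>_. \<alpha>opt) x0 (\<lambda>k. S k \<omega>) (J \<omega>)))
            - (INF x. avg_fun n f x)
          \<le> conv_const n Lmax L\<gamma> \<tau> \<gamma> \<alpha>opt * ((norm (x0 - xstar))\<^sup>2 / real K)
        \<and> conv_const n Lmax L\<gamma> \<tau> \<gamma> \<alpha>opt * ((norm (x0 - xstar))\<^sup>2 / real K)
          = L_gamma_tau n \<tau> \<gamma> Lmax L\<gamma> * (1 + \<gamma> * Lmax) * ((norm (x0 - xstar))\<^sup>2 / real K))"
proof -
  let ?Lt = "L_gamma_tau n \<tau> \<gamma> Lmax L\<gamma>"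
  have L_le: "L i \<le> Lmax" if "i \<in> {1..n}" for i
    using that assms(1) by (auto intro: Max_ge)
  have Lmax_pos: "Lmax > 0"
    using L_le[of 1] assms(2) assms(5)[of 1] by simp
  interpret interpolated_family n f L \<gamma> L\<gamma> Lmax xstar
    using assms L_le by unfold_locales auto
  have \<tau>: "1 \<le> \<tau>" "\<tau> \<le> n" using assms(3) by auto
  \<comment> \<open>Monotonicity of t/(1 + \<gamma>t) turns the averaged bound on
    \<open>L\<gamma>\<close> into the bound by Lmax/(1 + \<gamma>Lmax) required by
    \<open>L_gamma_tau_bounds\<close>.\<close>
  have "L i / (1 + \<gamma> * L i) \<le> Lmax / (1 + \<gamma> * Lmax)" if i: "i \<in> {1..n}" for i
  proof -
    have "1 + \<gamma> * L i > 0" using assms(5)[OF i] assms(8) by (simp add: add_pos_pos)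
    then show ?thesis using one_plus_pos L_le[OF i] by (simp add: field_simps)
  qed
  then have "(1 / real n) * (\<Sum>i\<in>{1..n}. L i / (1 + \<gamma> * L i))
      \<le> (1 / real n) * (\<Sum>i\<in>{1..n}. Lmax / (1 + \<gamma> * Lmax))"
    by (intro mult_left_mono sum_mono) auto
  then have "L\<gamma> \<le> Lmax / (1 + \<gamma> * Lmax)"
    using assms(2,11) by simp
  note Lt = L_gamma_tau_bounds[OF assms(2) \<tau> assms(8) Lmax_pos assms(9) this]
  define p where "p = \<gamma> * ?Lt"
  have p: "0 < p" "p < 1" using Lt assms(8) by (auto simp: p_def)
  note rate = convergence[OF \<tau> assms(12-15) Lt(1)]
  have opt_mem: "1 / p \<in> {0<..<2 / p}" using p by (simp add: divide_strict_right_mono)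
  \<comment> \<open>Moving 1/\<gamma> into the numerator brings the constant to the form of
    \<open>is_arg_min_inverse_quadratic\<close>; the numerator times \<open>p\<close> is then the
    optimal value.\<close>
  have const_eq: "conv_const n Lmax L\<gamma> \<tau> \<gamma> = (\<lambda>a. ((1 + \<gamma> * Lmax) / \<gamma>) / (a * (2 - a * p)))"
    by (simp add: conv_const_def p_def fun_eq_iff mult.assoc mult.left_commute)
  have arg_min: "is_arg_min (conv_const n Lmax L\<gamma> \<tau> \<gamma>) (\<lambda>a. a \<in> {0<..<2 / p}) \<alpha> \<longleftrightarrow> \<alpha> = 1 / p" for \<alpha>
    unfolding const_eq using one_plus_pos assms(8) p by (intro is_arg_min_inverse_quadratic) auto
  have opt_const: "conv_const n Lmax L\<gamma> \<tau> \<gamma> (1 / p) = ?Lt * (1 + \<gamma> * Lmax)"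
    unfolding const_eq using p assms(8) by (simp add: p_def)
  then have opt_rate: "conv_const n Lmax L\<gamma> \<tau> \<gamma> (1 / p) * ((norm (x0 - xstar))\<^sup>2 / real K)
      = ?Lt * (1 + \<gamma> * Lmax) * ((norm (x0 - xstar))\<^sup>2 / real K)"
    by simp
  have "1 / p > 1" using p by simp
  then show ?thesis
    using rate opt_mem arg_min opt_rate unfolding Let_def p_def by blast
qed

end
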